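(* Let $G$ be a graph with $n$ vertices and $m$ edges, let $\lambda_{1} \geq \lambda_{2} \geq \ldots \geq \lambda_{n}$ be the eigenvalues of its adjacency matrix, let $E=\sum_{i=1}^{n}|\lambda_{i}|$ be its energy, and let $t=\min_{1\leq i\leq n}|\lambda_{i}|$. Then $$ E \geq \frac{2m+n\lambda_{1}t}{\lambda_{1}+t}. $$
   Context: Graphs are finite, simple and undirected. The adjacency matrix $A$ of a graph with $n$ vertices is the symmetric $n\times n$ matrix with entries in $\{0,1\}$ whose $(i,j)$ entry is $1$ exactly when vertices $i$ and $j$ are adjacent; its eigenvalues are listed with multiplicity. *)

theory Defs
  imports "HOL-Library.Multiset" "Jordan_Normal_Form.Char_Poly"
begin

definition simple_graph :: "'a set \<Rightarrow> 'a set set \<Rightarrow> bool" where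
  "simple_graph V E \<longleftrightarrow> finite V \<and> (\<forall>e\<in>E. e \<subseteq> V \<and> card e = 2)"

text \<open>The list \<open>vs\<close> enumerates the vertices and fixes the order of rows and columns.
  A singleton is never an edge of a simple graph, so the diagonal vanishes.\<close>

definition adjacency_matrix :: "'a list \<Rightarrow> 'a set set \<Rightarrow> real mat" where
  "adjacency_matrix vs E =
     mat (length vs) (length vs) (\<lambda>(i, j). if {vs ! i, vs ! j} \<in> E then 1 else 0)"

text \<open>Over a field the eigenvalues are the roots of the characteristic polynomial
  (\<open>eigenvalue_root_char_poly\<close>); \<open>proots\<close> counts them with multiplicity. Only real
  eigenvalues are listed, which for a symmetric real matrix are all of them.\<close>

definition eigenvalue_list :: "real mat \<Rightarrow> real list" where
  "eigenvalue_list A = rev (sorted_list_of_multiset (proots (char_poly A)))"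

text \<open>The index is shifted, so that \<open>nth_eigenvalue A 1\<close> is the largest eigenvalue.\<close>

definition nth_eigenvalue :: "real mat \<Rightarrow> nat \<Rightarrow> real" where
  "nth_eigenvalue A i = eigenvalue_list A ! (i - 1)"

end

theory Submission
  imports Defs "Jordan_Normal_Form.Schur_Decomposition"
begin

text \<open>
  Since the eigenvalues satisfy \<open>t \<le> \<bar>\<lambda>\<^sub>i\<bar> \<le> \<lambda>\<^sub>1\<close>, every product
  \<open>(\<bar>\<lambda>\<^sub>i\<bar> - t) * (\<lambda>\<^sub>1 - \<bar>\<lambda>\<^sub>i\<bar>)\<close> is nonnegative. Summing over all \<open>i\<close> and using that the
  squares of the eigenvalues add up to \<open>2 * m\<close> gives
  \<open>(\<lambda>\<^sub>1 + t) * energy \<ge> 2 * m + n * \<lambda>\<^sub>1 * t\<close>; if \<open>\<lambda>\<^sub>1 + t = 0\<close>, the quotient in the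
  bound is \<open>0\<close> by convention and nothing remains to be shown.

  Both facts about the eigenvalues come from traces of powers of the adjacency matrix \<open>A\<close>.
  The characteristic polynomial of a symmetric real matrix splits over the reals
  (\<open>char_poly_symmetric_splits\<close>), so \<open>A\<close> has a real Schur form, and the trace of
  \<open>A ^\<^sub>m k\<close> is the sum of the \<open>k\<close>-th powers of the eigenvalues (\<open>mat_trace_pow\<close>).
  For \<open>k = 2\<close> the trace counts the ordered pairs of adjacent vertices
  (\<open>mat_trace_adjacency_matrix_square\<close>). For odd \<open>k\<close> the trace is nonnegative because the
  entries of \<open>A\<close> are, whereas an eigenvalue below \<open>- \<lambda>\<^sub>1\<close> would make the power sum negative
  for large odd \<open>k\<close> (\<open>abs_le_if_odd_power_sums_nonneg\<close>); this replaces an appeal to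
  the Perron-Frobenius theorem.
\<close>

section \<open>Symmetric real matrices have only real eigenvalues\<close>

lemma complex_eigenvalue_symmetric_real:
  fixes A :: "real mat"
  assumes A: "A \<in> carrier_mat n n"
    and sym: "\<And>i j. i < n \<Longrightarrow> j < n \<Longrightarrow> A $$ (i, j) = A $$ (j, i)"
    and ev: "eigenvalue (map_mat complex_of_real A) c"
  shows "Im c = 0"
proof -
  let ?M = "map_mat complex_of_real A"
  obtain v where v: "v \<in> carrier_vec n" "v \<noteq> 0\<^sub>v n" and eq: "?M *\<^sub>v v = c \<cdot>\<^sub>v v"
    using ev A unfolding eigenvalue_def eigenvector_def by auto
  \<comment> \<open>Compute \<open>v\<^sup>* A v = c * s\<close>, where \<open>s = v\<^sup>* v\<close>: both \<open>s\<close> and, by symmetry of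
    \<open>A\<close>, the left-hand side equal their conjugates.\<close>
  define s where "s = (\<Sum>i<n. v $ i * cnj (v $ i))"
  have "v \<bullet>c v = s"
    using v(1) by (simp add: scalar_prod_def s_def lessThan_atLeast0)
  with v have s0: "s \<noteq> 0" by (metis conjugate_square_eq_0_vec)
  have s_real: "cnj s = s"
    by (simp add: s_def mult.commute)
  have row: "c * v $ i = (\<Sum>j<n. of_real (A $$ (i, j)) * v $ j)" if "i < n" for i
  proof -
    have "c * v $ i = (?M *\<^sub>v v) $ i" using eq that v(1) by simp
    also have "\<dots> = (\<Sum>j<n. of_real (A $$ (i, j)) * v $ j)"
      using that A v(1) by (simp add: scalar_prod_def lessThan_atLeast0)
    finally show ?thesis .
  qed
  have q: "c * s = (\<Sum>i<n. \<Sum>j<n. of_real (A $$ (i, j)) * v $ j * cnj (v $ i))"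
  proof -
    have "c * s = (\<Sum>i<n. (c * v $ i) * cnj (v $ i))"
      by (simp add: s_def sum_distrib_left mult.assoc)
    also have "\<dots> = (\<Sum>i<n. (\<Sum>j<n. of_real (A $$ (i, j)) * v $ j) * cnj (v $ i))"
      by (intro sum.cong refl) (simp add: row)
    finally show ?thesis by (simp add: sum_distrib_right)
  qed
  have "cnj (c * s) = (\<Sum>i<n. \<Sum>j<n. of_real (A $$ (i, j)) * cnj (v $ j) * v $ i)"
    by (simp only: q cnj_sum complex_cnj_mult complex_cnj_cnj complex_cnj_complex_of_real)
  also have "\<dots> = (\<Sum>j<n. \<Sum>i<n. of_real (A $$ (i, j)) * cnj (v $ j) * v $ i)"
    by (rule sum.swap)
  also have "\<dots> = c * s"
    unfolding q by (intro sum.cong refl) (simp add: sym mult.commute mult.left_commute)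
  finally have "cnj c * s = c * s" by (simp add: s_real)
  then have "cnj c = c" using s0 mult_right_cancel by blast
  then show ?thesis by (simp add: complex_eq_iff)
qed

lemma char_poly_symmetric_splits:
  fixes A :: "real mat"
  assumes A: "A \<in> carrier_mat n n"
    and sym: "\<And>i j. i < n \<Longrightarrow> j < n \<Longrightarrow> A $$ (i, j) = A $$ (j, i)"
  obtains es where "char_poly A = (\<Prod>e\<leftarrow>es. [:- e, 1:])" and "length es = n"
proof -
  let ?M = "map_mat complex_of_real A"
  have M: "?M \<in> carrier_mat n n" using A by simp
  obtain cs where cs: "char_poly ?M = (\<Prod>c\<leftarrow>cs. [:- c, 1:])" "length cs = n"
    using char_poly_factorized[OF M] by blast
  have real: "complex_of_real (Re c) = c" if "c \<in> set cs" for c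
  proof -
    have "poly (char_poly ?M) c = 0"
      using that unfolding cs(1) poly_prod_list by (force simp: prod_list_zero_iff)
    then have "eigenvalue ?M c" by (simp add: eigenvalue_root_char_poly[OF M])
    from complex_eigenvalue_symmetric_real[OF A sym this] show ?thesis
      by (simp add: complex_eq_iff)
  qed
  interpret h: map_poly_inj_idom_hom complex_of_real ..
  have "map_poly complex_of_real (\<Prod>e\<leftarrow>map Re cs. [:- e, 1:]) = (\<Prod>c\<leftarrow>cs. [:- c, 1:])"
    using real by (induction cs) (simp_all add: hom_distribs)
  also have "\<dots> = map_poly complex_of_real (char_poly A)"
    unfolding cs(1)[symmetric] by (rule of_real_hom.char_poly_hom[OF A])
  finally have "char_poly A = (\<Prod>e\<leftarrow>map Re cs. [:- e, 1:])" by simp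
  with cs(2) show ?thesis by (intro that[of "map Re cs"]) auto
qed

text \<open>Once the characteristic polynomial splits, restricting to real roots loses none of
  them, and the eigenvalue list has the full length.\<close>

lemma mset_eigenvalue_list:
  assumes "char_poly A = (\<Prod>e\<leftarrow>es. [:- e, 1:])"
  shows "mset (eigenvalue_list A) = mset es"
proof -
  have "proots (\<Prod>e\<leftarrow>es. [:- e, 1:]) = mset es"
    for es :: "real list"
  proof (induction es)
    case (Cons e es)
    have "(\<Prod>e\<leftarrow>es. [:- e, 1:]) \<noteq> (0 :: real poly)"
      by (auto simp: prod_list_zero_iff)
    then show ?case using Cons by (simp add: proots_mult del: mult_pCons_left)
  qed simp
  then show ?thesis using assms by (simp add: eigenvalue_list_def)
qed

section \<open>Power sums of the eigenvalues are traces of powers\<close>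

text \<open>The sum of the diagonal entries, meant for square matrices.\<close>

definition mat_trace :: "'a :: comm_monoid_add mat \<Rightarrow> 'a" where
  "mat_trace A = (\<Sum>i<dim_row A. A $$ (i, i))"

lemma mat_trace_mult:
  fixes A B :: "'a :: semiring_0 mat"
  assumes "A \<in> carrier_mat n k" and "B \<in> carrier_mat k n"
  shows "mat_trace (A * B) = (\<Sum>i<n. \<Sum>j<k. A $$ (i, j) * B $$ (j, i))"
  using assms by (simp add: mat_trace_def scalar_prod_def lessThan_atLeast0)

lemma mat_trace_mult_commute:
  fixes A B :: "'a :: comm_semiring_0 mat"
  assumes "A \<in> carrier_mat n k" and "B \<in> carrier_mat k n"
  shows "mat_trace (A * B) = mat_trace (B * A)"
  unfolding mat_trace_mult[OF assms] mat_trace_mult[OF assms(2,1)]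
  by (subst sum.swap) (simp add: mult.commute)

lemma mat_trace_similar:
  fixes A B :: "'a :: comm_semiring_1 mat"
  assumes A: "A \<in> carrier_mat n n" and wit: "similar_mat_wit A B P Q"
  shows "mat_trace A = mat_trace B"
proof -
  note w = similar_mat_witD2[OF A wit]
  have "mat_trace A = mat_trace (P * (B * Q))"
    using w by (simp add: assoc_mult_mat[of _ n n _ n _ n])
  also have "\<dots> = mat_trace (B * Q * P)"
    using w by (intro mat_trace_mult_commute) auto
  also have "B * Q * P = B"
    using w by (simp add: assoc_mult_mat[of _ n n _ n _ n])
  finally show ?thesis .
qed

text \<open>Triangularity of the powers is needed in the induction for the diagonal entries.\<close>

lemma upper_triangular_pow:
  fixes B :: "'a :: semiring_1 mat"
  assumes B: "B \<in> carrier_mat n n" and ut: "upper_triangular B"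
  shows "upper_triangular (B ^\<^sub>m k) \<and> (\<forall>i<n. (B ^\<^sub>m k) $$ (i, i) = (B $$ (i, i)) ^ k)"
proof (induction k)
  case 0
  show ?case using B by auto
next
  case (Suc k)
  define C where "C = B ^\<^sub>m k"
  have C: "C \<in> carrier_mat n n" using B by (simp add: C_def)
  have utC: "C $$ (i, j) = 0" if "j < i" "i < n" for i j
    using Suc that C by (auto simp: C_def[symmetric])
  have utB: "B $$ (i, j) = 0" if "j < i" "i < n" for i j
    using ut that B by auto
  have entry: "(C * B) $$ (i, j) = (\<Sum>l<n. C $$ (i, l) * B $$ (l, j))"
    if "i < n" "j < n" for i j
    using that B C by (simp add: scalar_prod_def lessThan_atLeast0)
  have "(C * B) $$ (i, j) = 0" if ij: "j < i" "i < n" for i j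
  proof -
    have "C $$ (i, l) * B $$ (l, j) = 0" if "l < n" for l
      using utC[of l i] utB[of j l] ij that by (cases "l < i") auto
    then show ?thesis using ij by (simp add: entry)
  qed
  moreover have "(C * B) $$ (i, i) = C $$ (i, i) * B $$ (i, i)" if i: "i < n" for i
  proof -
    have "C $$ (i, l) * B $$ (l, i) = 0" if "l < n" "l \<noteq> i" for l
      using utC[of l i] utB[of i l] i that by (cases "l < i") auto
    then have "(\<Sum>l<n. C $$ (i, l) * B $$ (l, i)) = (\<Sum>l\<in>{i}. C $$ (i, l) * B $$ (l, i))"
      using i by (intro sum.mono_neutral_right) auto
    then show ?thesis using i by (simp add: entry)
  qed
  ultimately show ?case
    using Suc B C by (auto simp: C_def[symmetric] power_commutes)
qed

lemma mat_trace_pow: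
  fixes A :: "'a :: conjugatable_ordered_field mat"
  assumes A: "A \<in> carrier_mat n n" and cp: "char_poly A = (\<Prod>e\<leftarrow>es. [:- e, 1:])"
  shows "mat_trace (A ^\<^sub>m k) = (\<Sum>e\<leftarrow>es. e ^ k)"
proof -
  obtain B P Q where schur: "schur_decomposition A es = (B, P, Q)"
    by (cases "schur_decomposition A es")
  from schur_decomposition[OF A cp schur]
  have wit: "similar_mat_wit A B P Q" and ut: "upper_triangular B" and diag: "diag_mat B = es"
    by auto
  have B: "B \<in> carrier_mat n n" using similar_mat_witD2[OF A wit] by simp
  have Ak: "A ^\<^sub>m k \<in> carrier_mat n n" using A by simp
  have "mat_trace (A ^\<^sub>m k) = mat_trace (B ^\<^sub>m k)"
    by (rule mat_trace_similar[OF Ak similar_mat_wit_pow[OF wit]])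
  also have "\<dots> = (\<Sum>i<n. (B $$ (i, i)) ^ k)"
    using upper_triangular_pow[OF B ut, of k] B by (simp add: mat_trace_def)
  also have "\<dots> = (\<Sum>e\<leftarrow>es. e ^ k)"
    using B by (simp add: diag[symmetric] diag_mat_def sum_list_sum_nth lessThan_atLeast0)
  finally show ?thesis .
qed

lemma mat_trace_pow_nonneg:
  fixes A :: "'a :: ordered_semiring_1 mat"
  assumes A: "A \<in> carrier_mat n n" and nonneg: "\<And>i j. i < n \<Longrightarrow> j < n \<Longrightarrow> 0 \<le> A $$ (i, j)"
  shows "0 \<le> mat_trace (A ^\<^sub>m k)"
proof -
  have "\<forall>i<n. \<forall>j<n. 0 \<le> (A ^\<^sub>m k) $$ (i, j)"
  proof (induction k)
    case 0
    show ?case using A by auto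
  next
    case (Suc k)
    moreover have "A ^\<^sub>m k \<in> carrier_mat n n" using A by simp
    ultimately show ?case
      using A nonneg by (auto simp: scalar_prod_def intro!: sum_nonneg mult_nonneg_nonneg)
  qed
  then show ?thesis using A by (auto simp: mat_trace_def intro!: sum_nonneg)
qed

section \<open>The largest eigenvalue dominates in absolute value\<close>

text \<open>If some \<open>x\<close> in the list had \<open>- x > b\<close>, then for large odd \<open>k\<close> the term
  \<open>x ^ k = - (- x) ^ k\<close> would outweigh all the others, each of which is at most \<open>b ^ k\<close>.
  The case \<open>k = 1\<close> excludes a negative \<open>b\<close>.\<close>

lemma abs_le_if_odd_power_sums_nonneg:
  fixes es :: "real list"
  assumes le: "\<And>x. x \<in> set es \<Longrightarrow> x \<le> b"
    and sums: "\<And>k. odd k \<Longrightarrow> 0 \<le> (\<Sum>x\<leftarrow>es. x ^ k)"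
    and x: "x \<in> set es"
  shows "\<bar>x\<bar> \<le> b"
proof (rule ccontr)
  assume "\<not> \<bar>x\<bar> \<le> b"
  with le[OF x] have neg: "x < 0" and xb: "b < - x" by auto
  have b: "0 \<le> b"
  proof (rule ccontr)
    assume "\<not> 0 \<le> b"
    then have "(\<Sum>y\<leftarrow>es. y) < (\<Sum>y\<leftarrow>es. 0)"
      using le x by (intro sum_list_strict_mono) force+
    then show False using sums[of 1] by simp
  qed
  define n where "n = length es"
  have n: "0 < n" using x by (auto simp: n_def)
  have "b / - x < 1" using neg xb by (simp add: divide_simps)
  then obtain N where N: "(b / - x) ^ N < 1 / n"
    using real_arch_pow_inv[of "1 / n" "b / - x"] n by auto
  \<comment> \<open>Any odd exponent at least \<open>N\<close> serves.\<close>
  define k where "k = 2 * N + 1"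
  have "(b / - x) ^ k \<le> (b / - x) ^ N"
    using b neg xb by (intro power_decreasing) (auto simp: k_def divide_simps)
  with N have "(b / - x) ^ k < 1 / n" by simp
  then have small: "n * b ^ k < (- x) ^ k"
    using n neg by (simp only: power_divide) (simp add: divide_simps mult.commute)
  obtain ys zs where es: "es = ys @ x # zs" using x by (meson split_list)
  have "odd k" by (simp add: k_def)
  have "(\<Sum>y\<leftarrow>ys @ zs. y ^ k) \<le> (\<Sum>y\<leftarrow>ys @ zs. b ^ k)"
    using le es \<open>odd k\<close> by (intro sum_list_mono power_mono_odd) auto
  also have "\<dots> \<le> n * b ^ k"
    using b by (simp add: sum_list_triv n_def es mult_right_mono algebra_simps)
  also have "\<dots> < (- x) ^ k" by (rule small)
  also have "\<dots> = - (x ^ k)" using \<open>odd k\<close> by simp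
  finally have "(\<Sum>y\<leftarrow>es. y ^ k) < 0" by (simp add: es)
  with sums[OF \<open>odd k\<close>] show False by simp
qed

section \<open>The adjacency matrix\<close>

text \<open>Handshaking: every edge is an unordered pair of distinct vertices and can be ordered in
  two ways.\<close>

lemma card_ordered_pairs_edges:
  assumes "simple_graph V E"
  shows "card {(u, w). {u, w} \<in> E} = 2 * card E"
proof -
  have finE: "finite E"
    using assms by (auto simp: simple_graph_def intro: finite_subset[of E "Pow V"])
  have two: "finite {(u, w). {u, w} = e} \<and> card {(u, w). {u, w} = e} = 2" if "e \<in> E" for e
  proof -
    have "card e = 2" using assms that by (simp add: simple_graph_def)
    then obtain a b where ab: "e = {a, b}" "a \<noteq> b" unfolding card_2_iff by auto
    then have "{(u, w). {u, w} = e} = {(a, b), (b, a)}" by (auto simp: doubleton_eq_iff)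
    then show ?thesis using ab by simp
  qed
  have "{(u, w). {u, w} \<in> E} = (\<Union>e\<in>E. {(u, w). {u, w} = e})" by auto
  also have "card \<dots> = (\<Sum>e\<in>E. card {(u, w). {u, w} = e})"
    using finE two by (intro card_UN_disjoint) auto
  finally show ?thesis using two by simp
qed

lemma mat_trace_adjacency_matrix_square:
  assumes G: "simple_graph V E" and vs: "distinct vs" "set vs = V"
  shows "mat_trace (adjacency_matrix vs E ^\<^sub>m 2) = 2 * real (card E)"
proof -
  define n where "n = length vs"
  define A where "A = adjacency_matrix vs E"
  have A: "A \<in> carrier_mat n n" by (simp add: A_def n_def adjacency_matrix_def)
  have entry: "A $$ (i, j) = of_bool ({vs ! i, vs ! j} \<in> E)" if "i < n" "j < n" for i j
    using that by (simp add: A_def n_def adjacency_matrix_def)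
  have "A ^\<^sub>m 2 = A * A" using A by (simp add: numeral_2_eq_2)
  then have "mat_trace (A ^\<^sub>m 2) = (\<Sum>i<n. \<Sum>j<n. A $$ (i, j) * A $$ (j, i))"
    by (simp add: mat_trace_mult[OF A A])
  \<comment> \<open>The two factors agree by symmetry, and their square is the entry itself, which is 0 or 1.\<close>
  also have "\<dots> = (\<Sum>i<n. \<Sum>j<n. of_bool ({vs ! i, vs ! j} \<in> E))"
    by (intro sum.cong refl) (simp add: entry insert_commute)
  also have "\<dots> = (\<Sum>(i, j)\<in>{..<n} \<times> {..<n}. of_bool ({vs ! i, vs ! j} \<in> E))"
    by (rule sum.cartesian_product)
  also have "\<dots> = (\<Sum>(u, w)\<in>V \<times> V. of_bool ({u, w} \<in> E))"
  proof -
    have "bij_betw ((!) vs) {..<n} V"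
      using bij_betw_nth[OF vs(1) refl vs(2)[symmetric]] by (simp add: n_def)
    then have "bij_betw (map_prod ((!) vs) ((!) vs)) ({..<n} \<times> {..<n}) (V \<times> V)"
      by (simp add: bij_betw_map_prod)
    from sum.reindex_bij_betw[OF this, of "\<lambda>(u, w). of_bool ({u, w} \<in> E)"]
    show ?thesis by (simp add: case_prod_unfold del: sum_of_bool_eq)
  qed
  also have "\<dots> = card {(u, w). {u, w} \<in> E}"
  proof -
    have "{(u, w). {u, w} \<in> E} = {p \<in> V \<times> V. case p of (u, w) \<Rightarrow> {u, w} \<in> E}"
      using G by (auto simp: simple_graph_def)
    moreover have "finite (V \<times> V)" using G by (simp add: simple_graph_def)
    ultimately show ?thesis
      by (simp add: case_prod_unfold of_bool_def sum.If_cases Int_def)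
  qed
  finally show ?thesis by (simp add: A_def card_ordered_pairs_edges[OF G])
qed

section \<open>The energy bound\<close>

theorem theorem3p1:
  fixes V :: "'a set" and E :: "'a set set" and vs :: "'a list"
    and n m :: nat and ev :: "nat \<Rightarrow> real" and energy t :: real
  assumes "simple_graph V E"
    and "V \<noteq> {}"
    and "distinct vs" and "set vs = V"
    and "n = card V" and "m = card E"
    and "ev = nth_eigenvalue (adjacency_matrix vs E)"
    and "energy = (\<Sum>i=1..n. \<bar>ev i\<bar>)"
    and "t = Min ((\<lambda>i. \<bar>ev i\<bar>) ` {1..n})"
  shows "energy \<ge> (2 * real m + real n * ev 1 * t) / (ev 1 + t)"
proof -
  define A where "A = adjacency_matrix vs E"
  define ls where "ls = eigenvalue_list A"
  have len_vs: "length vs = n" using assms(3-5) distinct_card by metis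
  have n: "0 < n" using assms(1,2,5) by (simp add: simple_graph_def card_gt_0_iff)
  have A: "A \<in> carrier_mat n n" by (simp add: A_def adjacency_matrix_def len_vs)
  have sym: "A $$ (i, j) = A $$ (j, i)" if "i < n" "j < n" for i j
    using that by (simp add: A_def adjacency_matrix_def len_vs insert_commute)
  have A_nonneg: "0 \<le> A $$ (i, j)" if "i < n" "j < n" for i j
    using that by (simp add: A_def adjacency_matrix_def len_vs)
  obtain es where cp: "char_poly A = (\<Prod>e\<leftarrow>es. [:- e, 1:])" and len_es: "length es = n"
    using char_poly_symmetric_splits[OF A sym] .
  have mset: "mset ls = mset es" unfolding ls_def by (rule mset_eigenvalue_list[OF cp])
  then have len: "length ls = n" using len_es by (metis size_mset)
  have ev: "ev i = ls ! (i - 1)" for i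
    by (simp add: assms(7) nth_eigenvalue_def ls_def A_def)
  have trace: "(\<Sum>x\<leftarrow>ls. x ^ k) = mat_trace (A ^\<^sub>m k)" for k
    unfolding mat_trace_pow[OF A cp] by (metis mset mset_map sum_mset_sum_list)
  have sum_ev: "(\<Sum>i=1..n. f (ev i)) = (\<Sum>x\<leftarrow>ls. f x)" for f :: "real \<Rightarrow> real"
  proof -
    have "(\<Sum>i=1..n. f (ev i)) = (\<Sum>i=0..<n. f (ls ! i))"
      by (rule sum.reindex_bij_witness[of _ Suc "\<lambda>i. i - 1"]) (auto simp: ev)
    then show ?thesis by (simp add: sum_list_sum_nth len)
  qed
  have ev_in: "ev i \<in> set ls" if "i \<in> {1..n}" for i
    using that len by (auto simp: ev intro!: nth_mem)
  have largest: "x \<le> ev 1" if x: "x \<in> set ls" for x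
  proof -
    have "sorted_wrt (\<ge>) ls"
      by (simp add: ls_def eigenvalue_list_def sorted_wrt_rev)
    moreover obtain i where "i < n" "x = ls ! i" using x by (auto simp: in_set_conv_nth len)
    ultimately show ?thesis
      using sorted_wrt_nth_less[of "(\<ge>)" ls 0 i] by (cases "i = 0") (auto simp: ev len)
  qed
  have upper: "\<bar>ev i\<bar> \<le> ev 1" if "i \<in> {1..n}" for i
  proof (rule abs_le_if_odd_power_sums_nonneg[OF largest _ ev_in[OF that]])
    show "0 \<le> (\<Sum>x\<leftarrow>ls. x ^ k)" for k
      unfolding trace by (rule mat_trace_pow_nonneg[OF A A_nonneg])
  qed
  have squares: "(\<Sum>i=1..n. (ev i)\<^sup>2) = 2 * real m"
  proof -
    have "(\<Sum>i=1..n. (ev i)\<^sup>2) = (\<Sum>x\<leftarrow>ls. x\<^sup>2)" by (rule sum_ev)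
    also have "\<dots> = mat_trace (A ^\<^sub>m 2)" by (rule trace)
    also have "\<dots> = 2 * real m"
      unfolding A_def assms(6) by (rule mat_trace_adjacency_matrix_square[OF assms(1,3,4)])
    finally show ?thesis .
  qed
  have lower: "t \<le> \<bar>ev i\<bar>" if "i \<in> {1..n}" for i
    using that by (simp add: assms(9))
  have "t \<in> (\<lambda>i. \<bar>ev i\<bar>) ` {1..n}"
    unfolding assms(9) using n by (intro Min_in) auto
  then have t: "0 \<le> t" by auto
  have ev1: "0 \<le> ev 1" using upper[of 1] n by auto
  have "0 \<le> (\<Sum>i=1..n. (\<bar>ev i\<bar> - t) * (ev 1 - \<bar>ev i\<bar>))"
    using lower upper by (intro sum_nonneg mult_nonneg_nonneg) auto
  also have "\<dots> = (\<Sum>i=1..n. (ev 1 + t) * \<bar>ev i\<bar> - (ev i)\<^sup>2 - ev 1 * t)"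
    by (intro sum.cong refl) (simp add: algebra_simps power2_eq_square flip: abs_mult)
  also have "\<dots> = (ev 1 + t) * energy - 2 * real m - real n * ev 1 * t"
    by (simp only: sum_subtractf squares assms(8) sum_distrib_left) simp
  finally have main: "2 * real m + real n * ev 1 * t \<le> energy * (ev 1 + t)"
    by (simp add: mult.commute)
  show ?thesis
  proof (cases "ev 1 + t = 0")
    case True
    then show ?thesis by (simp add: assms(8) sum_nonneg)
  next
    case False
    with ev1 t have "0 < ev 1 + t" by simp
    with main show ?thesis by (simp add: pos_divide_le_eq)
  qed
qed

end
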